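(* Let $S$ be a cancellative left-amenable semigroup and let $A$ be a finite set. Then every injective cellular automaton $\tau \colon A^S \to A^S$ is surjective.
   Context: A semigroup is a set with an associative binary operation. For $s \in S$, let $L_s, R_s \colon S \to S$ be $L_s(t) = st$, $R_s(t) = ts$. The semigroup $S$ is cancellative if $L_s$ and $R_s$ are injective for every $s \in S$. A mean on $S$ is an $\mathbb{R}$-linear map $m \colon \ell^\infty(S) \to \mathbb{R}$ ($\ell^\infty(S)$ being the space of bounded maps $f \colon S \to \mathbb{R}$) with $\inf_{s \in S} f(s) \le m(f) \le \sup_{s \in S} f(s)$ for all $f$. It is left-invariant if $m(f \circ L_s) = m(f)$ for all $f \in \ell^\infty(S)$, $s \in S$. The semigroup $S$ is left-amenable if it admits a left-invariant mean. $A^S$ is the set of all maps (configurations) $x \colon S \to A$. For $s \in S$ and $x \in A^S$, define $sx \in A^S$ by $(sx)(t) = x(ts)$. A map $\tau \colon A^S \to A^S$ is a cellular automaton if there exist a finite subset $M \subset S$ and a map $\mu \colon A^M \to A$ such that $\tau(x)(s) = \mu((sx)|_M)$ for all $x \in A^S$, $s \in S$. *)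

theory Defs
  imports "HOL-Analysis.Analysis"
begin

text \<open>A semigroup is a type of class \<^class>\<open>semigroup_mult\<close>; properties of the semigroup as a
  whole are predicates on its type token.\<close>

definition left_mult :: "'s::semigroup_mult \<Rightarrow> 's \<Rightarrow> 's"
  where "left_mult s t = s * t"

definition right_mult :: "'s::semigroup_mult \<Rightarrow> 's \<Rightarrow> 's"
  where "right_mult s t = t * s"

definition cancellative :: "'s::semigroup_mult itself \<Rightarrow> bool"
  where "cancellative S \<longleftrightarrow> (\<forall>s::'s. inj (left_mult s) \<and> inj (right_mult s))"

definition linf :: "('s \<Rightarrow> real) set"
  where "linf = {f. bounded (range f)}"

text \<open>A mean is a total function constrained only on \<^term>\<open>linf\<close>; its values elsewhere are
  irrelevant. Since \<open>f\<close> is bounded and types are nonempty, \<open>INF\<close> and \<open>SUP\<close> are the genuine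
  infimum and supremum.\<close>

definition is_mean :: "(('s \<Rightarrow> real) \<Rightarrow> real) \<Rightarrow> bool"
  where "is_mean m \<longleftrightarrow>
    (\<forall>f\<in>linf. \<forall>g\<in>linf. m (\<lambda>s. f s + g s) = m f + m g) \<and>
    (\<forall>f\<in>linf. \<forall>c. m (\<lambda>s. c * f s) = c * m f) \<and>
    (\<forall>f\<in>linf. (INF s. f s) \<le> m f \<and> m f \<le> (SUP s. f s))"

definition left_invariant :: "(('s::semigroup_mult \<Rightarrow> real) \<Rightarrow> real) \<Rightarrow> bool"
  where "left_invariant m \<longleftrightarrow> (\<forall>f\<in>linf. \<forall>s. m (f \<circ> left_mult s) = m f)"

definition left_amenable :: "'s::semigroup_mult itself \<Rightarrow> bool"
  where "left_amenable S \<longleftrightarrow> (\<exists>m :: ('s \<Rightarrow> real) \<Rightarrow> real. is_mean m \<and> left_invariant m)"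

definition configs :: "'a set \<Rightarrow> ('s \<Rightarrow> 'a) set"
  where "configs A = UNIV \<rightarrow> A"

definition shift :: "'s::semigroup_mult \<Rightarrow> ('s \<Rightarrow> 'a) \<Rightarrow> 's \<Rightarrow> 'a"
  where "shift s x = (\<lambda>t. x (t * s))"

definition cellular_automaton ::
    "'a set \<Rightarrow> (('s::semigroup_mult \<Rightarrow> 'a) \<Rightarrow> 's \<Rightarrow> 'a) \<Rightarrow> bool"
  where "cellular_automaton A \<tau> \<longleftrightarrow>
    \<tau> \<in> configs A \<rightarrow> configs A \<and>
    (\<exists>M \<mu>. finite M \<and> \<mu> \<in> (M \<rightarrow>\<^sub>E A) \<rightarrow> A \<and>
      (\<forall>x\<in>configs A. \<forall>s. \<tau> x s = \<mu> (restrict (shift s x) M)))"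

end

theory Submission
  imports Defs
begin

text \<open>If the finite sets all grow by a definite factor under some finite set of left
  multiplications, then after iteration they double, and Hall's theorem produces a paradoxical
  decomposition, which no left-invariant mean tolerates. So there are finite sets \<open>F\<close> that are almost
  invariant under any given finite set of left multiplications. If \<open>\<tau>\<close> is not surjective, compactness
  gives a finite pattern that no image contains, nor, by equivariance, any right translate of it.
  Disjoint translates fill a fixed proportion of \<open>F\<close>, so the patterns of images on a slight
  enlargement of \<open>F\<close> are exponentially fewer than the patterns on \<open>F\<close>, against injectivity.\<close>

section \<open>Compactness and Hall's theorem\<close>

text \<open>A product of finite discrete spaces is compact. By \<open>local\<close>, the choices
  satisfying \<open>Q I\<close> form a closed set, since a cylinder fixing the coordinates in
  \<open>I\<close> separates any point outside it. By \<open>mono\<close>, a choice that is good for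
  a finite union is good for each member, which gives the finite intersection property.\<close>

lemma finite_choice_compactness:
  fixes X :: "'i \<Rightarrow> 'b set" and Q :: "'i set \<Rightarrow> ('i \<Rightarrow> 'b) \<Rightarrow> bool"
  assumes fin: "\<And>i. finite (X i)"
    and local: "\<And>I f g. finite I \<Longrightarrow> f \<in> Pi UNIV X \<Longrightarrow> g \<in> Pi UNIV X \<Longrightarrow>
      (\<And>i. i \<in> I \<Longrightarrow> f i = g i) \<Longrightarrow> Q I f \<Longrightarrow> Q I g"
    and mono: "\<And>I J f. finite J \<Longrightarrow> f \<in> Pi UNIV X \<Longrightarrow> I \<subseteq> J \<Longrightarrow> Q J f \<Longrightarrow> Q I f"
    and ex: "\<And>I. finite I \<Longrightarrow> \<exists>f\<in>Pi UNIV X. Q I f"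
  obtains f where "f \<in> Pi UNIV X" "\<And>I. finite I \<Longrightarrow> Q I f"
proof -
  define Y where "Y = product_topology (\<lambda>i. discrete_topology (X i)) UNIV"
  have top: "topspace Y = Pi UNIV X"
    by (simp add: Y_def PiE_UNIV_domain)
  have comp: "compact_space Y"
    unfolding Y_def compact_space_product_topology
    by (simp add: fin compact_space_discrete_topology)
  define D where "D I = {f \<in> Pi UNIV X. Q I f}" for I
  have closed: "closedin Y (D I)" if I: "finite I" for I
  proof -
    have "openin Y (topspace Y - D I)"
    proof (subst openin_subopen, intro ballI)
      fix f assume f: "f \<in> topspace Y - D I"
      define U where "U = Pi UNIV (\<lambda>i. if i \<in> I then {f i} else X i)"
      have "openin Y (\<Pi>\<^sub>E i\<in>UNIV. if i \<in> I then {f i} else X i)"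
        unfolding Y_def
      proof (rule product_topology_basis)
        show "openin (discrete_topology (X i)) (if i \<in> I then {f i} else X i)" for i
          using f by (auto simp: top)
        show "finite {i. (if i \<in> I then {f i} else X i) \<noteq> topspace (discrete_topology (X i))}"
          by (rule finite_subset[OF _ I]) auto
      qed
      then have "openin Y U"
        by (simp add: U_def PiE_UNIV_domain)
      moreover have "f \<in> U"
        using f by (auto simp: U_def top)
      moreover have "U \<subseteq> topspace Y - D I"
      proof
        fix g assume g: "g \<in> U"
        have gI: "g i = f i" if "i \<in> I" for i
          using g that by (auto simp: U_def Pi_iff split: if_splits)
        have gX: "g \<in> Pi UNIV X"
        proof
          show "g i \<in> X i" for i
            using g f gI[of i] by (cases "i \<in> I") (auto simp: U_def top Pi_iff split: if_splits)
        qed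
        moreover have "\<not> Q I g"
          using local[OF I gX, of f] gI f by (auto simp: top D_def)
        ultimately show "g \<in> topspace Y - D I"
          by (auto simp: top D_def)
      qed
      ultimately show "\<exists>U. openin Y U \<and> f \<in> U \<and> U \<subseteq> topspace Y - D I"
        by blast
    qed
    then show ?thesis
      by (auto simp: closedin_def top D_def)
  qed
  have "\<Inter>(D ` {I. finite I}) \<noteq> {}"
  proof (rule compact_space_fip[THEN iffD1, OF comp, rule_format], intro conjI allI impI ballI)
    show "closedin Y C" if "C \<in> D ` {I. finite I}" for C
      using that closed by auto
    fix \<F> assume F: "finite \<F> \<and> \<F> \<subseteq> D ` {I. finite I}"
    then obtain \<I> where \<I>: "finite \<I>" "\<I> \<subseteq> {I. finite I}" "\<F> = D ` \<I>"
      using finite_subset_image by metis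
    then have fU: "finite (\<Union>\<I>)" by auto
    from ex[OF this] obtain f where f: "f \<in> Pi UNIV X" "Q (\<Union>\<I>) f" by auto
    have "f \<in> D I" if "I \<in> \<I>" for I
      unfolding D_def using f mono[OF fU f(1) _ f(2), of I] that by auto
    then show "\<Inter>\<F> \<noteq> {}" using \<I> by auto
  qed
  then obtain f where "\<And>I. finite I \<Longrightarrow> f \<in> D I" by auto
  then show ?thesis
    using that[of f] by (auto simp: D_def)
qed

text \<open>Rado's argument: in a minimal family satisfying Hall's condition no set has two elements.\<close>

lemma hall_finite:
  fixes N :: "'i \<Rightarrow> 'b set"
  assumes "finite I" "\<And>i. i \<in> I \<Longrightarrow> finite (N i)"
    and "\<And>J. J \<subseteq> I \<Longrightarrow> card J \<le> card (\<Union>(N ` J))"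
  shows "\<exists>f. inj_on f I \<and> (\<forall>i\<in>I. f i \<in> N i)"
  using assms(2,3)
proof (induction "\<Sum>i\<in>I. card (N i)" arbitrary: N rule: less_induct)
  case less
  note fin = less.prems(1) and hall = less.prems(2)
  show ?case
  proof (cases "\<exists>i\<in>I. \<exists>x\<in>N i. \<exists>y\<in>N i. x \<noteq> y")
    case False
    have ne: "N i \<noteq> {}" if "i \<in> I" for i
      using hall[of "{i}"] that by auto
    define f where "f i = (SOME x. x \<in> N i)" for i
    have f: "f i \<in> N i" if "i \<in> I" for i
      using ne[OF that] unfolding f_def by (simp add: some_in_eq)
    have N: "N i = {f i}" if "i \<in> I" for i
      using False f[OF that] that by auto
    have "inj_on f I"
    proof (rule inj_onI, rule ccontr)
      fix i j assume ij: "i \<in> I" "j \<in> I" "f i = f j" "i \<noteq> j"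
      then show False using hall[of "{i,j}"] N by auto
    qed
    then show ?thesis using f by auto
  next
    case True
    then obtain i x y where i: "i \<in> I" and xy: "x \<in> N i" "y \<in> N i" "x \<noteq> y" by auto
    define R where "R z = N(i := N i - {z})" for z
    have shrink: "\<exists>f. inj_on f I \<and> (\<forall>j\<in>I. f j \<in> N j)"
      if z: "z \<in> N i" and h: "\<And>J. J \<subseteq> I \<Longrightarrow> card J \<le> card (\<Union>(R z ` J))" for z
    proof -
      have "(\<Sum>j\<in>I. card (R z j)) < (\<Sum>j\<in>I. card (N j))"
        using i z fin[OF i] card_Diff1_less[OF fin[OF i] z]
        by (intro sum_strict_mono_ex1 assms(1))
           (auto simp: R_def card_mono)
      then have "\<exists>f. inj_on f I \<and> (\<forall>j\<in>I. f j \<in> R z j)"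
        using h fin by (intro less.hyps) (auto simp: R_def)
      then show ?thesis
        by (fastforce simp: R_def split: if_splits)
    qed
    show ?thesis
    proof (rule ccontr)
      assume no: "\<not> ?thesis"
      \<comment> \<open>By minimality, removing \<open>z\<close> from \<open>N i\<close> breaks
        Hall's condition, and only a subfamily containing \<open>i\<close> can be the witness.
        Dropping \<open>i\<close> from that subfamily lowers its size by one, so the strict
        inequality becomes a weak one.\<close>
      have bad: "\<exists>J. J \<subseteq> I - {i} \<and> card (\<Union>(N ` J) \<union> (N i - {z})) \<le> card J" if z: "z \<in> N i" for z
      proof -
        obtain J where J: "J \<subseteq> I" "card (\<Union>(R z ` J)) < card J"
          using shrink[OF z] no by (meson not_less)
        have iJ: "i \<in> J"
        proof (rule ccontr)
          assume "i \<notin> J"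
          then have "R z ` J = N ` J" by (auto simp: R_def)
          then show False using J hall[OF J(1)] by simp
        qed
        have "\<Union>(R z ` J) = \<Union>(N ` (J - {i})) \<union> (N i - {z})"
          using iJ by (auto simp: R_def split: if_splits)
        moreover have "card J = Suc (card (J - {i}))"
          using iJ J(1) assms(1) by (metis card_Suc_Diff1 finite_subset)
        ultimately show ?thesis
          using J by (intro exI[of _ "J - {i}"]) auto
      qed
      obtain J1 J2 where J1: "J1 \<subseteq> I - {i}" "card (\<Union>(N ` J1) \<union> (N i - {x})) \<le> card J1"
        and J2: "J2 \<subseteq> I - {i}" "card (\<Union>(N ` J2) \<union> (N i - {y})) \<le> card J2"
        using bad xy by meson
      define U1 where "U1 = \<Union>(N ` J1) \<union> (N i - {x})"
      define U2 where "U2 = \<Union>(N ` J2) \<union> (N i - {y})"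
      have finJ: "finite J1" "finite J2"
        using J1 J2 assms(1) by (meson finite_Diff finite_subset)+
      have finU: "finite U1" "finite U2"
        using J1 J2 finJ fin i by (auto simp: U1_def U2_def)
      \<comment> \<open>Since \<open>x\<close> and \<open>y\<close> differ, the union recovers all
        of \<open>N i\<close>. Hall's condition then gives one more than
        \<open>card (J1 \<union> J2)\<close> for the union and at least
        \<open>card (J1 \<inter> J2)\<close> for the intersection. Adding the two contradicts the
        bounds on \<open>U1\<close> and \<open>U2\<close>.\<close>
      have "U1 \<union> U2 = \<Union>(N ` insert i (J1 \<union> J2))"
        using xy by (auto simp: U1_def U2_def)
      moreover have "insert i (J1 \<union> J2) \<subseteq> I"
        using J1 J2 i by auto
      ultimately have "card (insert i (J1 \<union> J2)) \<le> card (U1 \<union> U2)"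
        using hall by metis
      moreover have "i \<notin> J1 \<union> J2"
        using J1 J2 by auto
      ultimately have 1: "Suc (card (J1 \<union> J2)) \<le> card (U1 \<union> U2)"
        using finJ by simp
      have "card (J1 \<inter> J2) \<le> card (\<Union>(N ` (J1 \<inter> J2)))"
        using J1 by (intro hall) auto
      also have "\<dots> \<le> card (U1 \<inter> U2)"
        using finU by (intro card_mono) (auto simp: U1_def U2_def)
      finally have 2: "card (J1 \<inter> J2) \<le> card (U1 \<inter> U2)" .
      show False
        using card_Un_Int[OF finU] card_Un_Int[OF finJ] 1 2 J1(2) J2(2)
        unfolding U1_def[symmetric] U2_def[symmetric] by linarith
    qed
  qed
qed

text \<open>Finite subfamilies are served by \<open>hall_finite\<close>. Compactness applies because
  all \<open>N i\<close> are finite, and injectivity of the limit is a condition on pairs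
  only.\<close>

lemma hall:
  fixes N :: "'i \<Rightarrow> 'b set"
  assumes fin: "\<And>i. finite (N i)"
    and hall: "\<And>J. finite J \<Longrightarrow> card J \<le> card (\<Union>(N ` J))"
  obtains f where "inj f" "\<And>i. f i \<in> N i"
proof -
  have ne: "N i \<noteq> {}" for i
    using hall[of "{i}"] by auto
  have ex: "\<exists>f\<in>Pi UNIV N. inj_on f I" if I: "finite I" for I
  proof -
    have "card J \<le> card (\<Union>(N ` J))" if "J \<subseteq> I" for J
      using hall finite_subset[OF that I] by blast
    from hall_finite[of I N, OF I fin this]
    obtain f where f: "inj_on f I" "\<And>i. i \<in> I \<Longrightarrow> f i \<in> N i" by auto
    define g where "g i = (if i \<in> I then f i else (SOME x. x \<in> N i))" for i
    have "inj_on g I"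
      using f(1) by (auto simp: g_def inj_on_def)
    moreover have "g \<in> Pi UNIV N"
      using f(2) ne by (auto simp: g_def some_in_eq)
    ultimately show ?thesis by blast
  qed
  obtain f where fN: "f \<in> Pi UNIV N" and f: "\<And>I. finite I \<Longrightarrow> inj_on f I"
  proof (rule finite_choice_compactness[of N "\<lambda>I f. inj_on f I"])
    show "inj_on g I" if "\<And>i. i \<in> I \<Longrightarrow> f i = g i" "inj_on f I" for I and f g :: "'i \<Rightarrow> 'b"
      using that by (auto simp: inj_on_def)
  qed (use fin ex in \<open>auto intro: inj_on_subset\<close>)
  have "inj f"
  proof (rule injI)
    fix i j assume eq: "f i = f j"
    show "i = j" by (rule inj_onD[OF f[of "{i,j}"] eq]) auto
  qed
  then show ?thesis
    using that[of f] fN by auto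
qed

section \<open>Means and Foelner sets\<close>

lemma linf_bounded:
  assumes "\<And>s. \<bar>f s\<bar> \<le> c"
  shows "f \<in> linf"
  unfolding linf_def using assms by (auto simp: bounded_iff)

lemma linf_comp: "f \<in> linf \<Longrightarrow> f \<circ> g \<in> linf"
  unfolding linf_def by (auto elim!: bounded_subset)

lemma linf_add: "f \<in> linf \<Longrightarrow> g \<in> linf \<Longrightarrow> (\<lambda>s. f s + g s) \<in> linf"
  unfolding linf_def mem_Collect_eq bounded_iff
  by (auto, meson abs_triangle_ineq add_mono order_trans)

lemma linf_const: "(\<lambda>s. c) \<in> linf"
  by (rule linf_bounded[of _ "\<bar>c\<bar>"]) simp

lemma linf_sum: "(\<And>i. i \<in> I \<Longrightarrow> f i \<in> linf) \<Longrightarrow> (\<lambda>s. \<Sum>i\<in>I. f i s) \<in> linf"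
  by (induction I rule: infinite_finite_induct) (auto intro: linf_add linf_const)

lemma mean_const:
  assumes "is_mean m"
  shows "m (\<lambda>s. c) = c"
  using assms linf_const[of c] unfolding is_mean_def by fastforce

lemma mean_le:
  assumes "is_mean m" "f \<in> linf" "\<And>s. f s \<le> c"
  shows "m f \<le> c"
proof -
  have "m f \<le> (SUP s. f s)"
    using assms unfolding is_mean_def by blast
  also have "\<dots> \<le> c"
    using assms(3) by (intro cSUP_least) auto
  finally show ?thesis .
qed

lemma mean_sum:
  assumes m: "is_mean m" and "\<And>i. i \<in> I \<Longrightarrow> f i \<in> linf"
  shows "m (\<lambda>s. \<Sum>i\<in>I. f i s) = (\<Sum>i\<in>I. m (f i))"
  using assms(2)
proof (induction I rule: infinite_finite_induct)
  case (insert i I)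
  have "m (\<lambda>s. f i s + (\<Sum>i\<in>I. f i s)) = m (f i) + m (\<lambda>s. \<Sum>i\<in>I. f i s)"
    using m insert.prems linf_sum[of I f] unfolding is_mean_def by simp
  then show ?case using insert by simp
qed (auto simp: mean_const[OF m])

text \<open>If every finite set is at least doubled by \<open>G\<close>, Hall's theorem yields two families of
  pieces \<open>B (g, b)\<close>, each partitioning the space, whose images under \<open>g\<close> are all disjoint.\<close>

lemma mean_not_doubling:
  fixes m :: "('s \<Rightarrow> real) \<Rightarrow> real" and G :: "('s \<Rightarrow> 's) set"
  assumes m: "is_mean m" and G: "finite G"
    and inj: "\<And>g. g \<in> G \<Longrightarrow> inj g"
    and inv: "\<And>g f. g \<in> G \<Longrightarrow> f \<in> linf \<Longrightarrow> m (f \<circ> g) = m f"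
  shows "\<exists>F. finite F \<and> card (\<Union>g\<in>G. g ` F) < 2 * card F"
proof (rule ccontr)
  assume "\<not> ?thesis"
  then have dbl: "2 * card F \<le> card (\<Union>g\<in>G. g ` F)" if "finite F" for F
    using that by (meson not_less)
  \<comment> \<open>Each point is listed twice, once per boolean, so that doubling becomes exactly
    Hall's condition.\<close>
  define N :: "'s \<times> bool \<Rightarrow> 's set" where "N p = (\<lambda>g. g (fst p)) ` G" for p
  obtain \<phi> where \<phi>: "inj \<phi>" "\<And>p. \<phi> p \<in> N p"
  proof (rule hall[of N])
    show "finite (N p)" for p using G by (simp add: N_def)
    fix J :: "('s \<times> bool) set" assume J: "finite J"
    have "card J \<le> card (fst ` J \<times> (UNIV :: bool set))"
      using J by (intro card_mono) (auto intro: rev_image_eqI)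
    also have "\<dots> = 2 * card (fst ` J)"
      by (simp add: card_cartesian_product)
    also have "\<dots> \<le> card (\<Union>g\<in>G. g ` fst ` J)"
      using J by (intro dbl) simp
    also have "(\<Union>g\<in>G. g ` fst ` J) = \<Union>(N ` J)"
      by (auto simp: N_def)
    finally show "card J \<le> card (\<Union>(N ` J))" .
  qed blast
  have "\<forall>p. \<exists>g\<in>G. \<phi> p = g (fst p)"
    using \<phi>(2) unfolding N_def image_iff by blast
  then obtain \<gamma> where \<gamma>: "\<And>p. \<gamma> p \<in> G" "\<And>p. \<phi> p = \<gamma> p (fst p)" by metis
  \<comment> \<open>\<open>B (g, b)\<close> holds the points whose copy \<open>b\<close> is matched
    through \<open>g\<close>. For fixed \<open>b\<close> these pieces partition the space.\<close>
  define B where "B p = {s. \<gamma> (s, snd p) = fst p}" for p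
  let ?I = "G \<times> (UNIV :: bool set)"
  have ind: "indicat_real C \<in> linf" for C :: "'s set"
    by (rule linf_bounded[of _ 1]) (simp add: indicator_def)
  have same: "m (indicat_real (fst p ` B p)) = m (indicat_real (B p))" if p: "p \<in> ?I" for p
  proof -
    have "indicat_real (fst p ` B p) \<circ> fst p = indicat_real (B p)"
      using inj[of "fst p"] p by (auto simp: fun_eq_iff indicator_def dest: injD)
    then show ?thesis
      using inv[of "fst p", OF _ ind] p by (metis mem_Times_iff)
  qed
  have two: "(\<Sum>p\<in>?I. indicat_real (B p) s) = 2" for s
  proof -
    have "(\<Sum>p\<in>?I. indicat_real (B p) s) = (\<Sum>b\<in>(UNIV::bool set). \<Sum>g\<in>G. indicat_real (B (g, b)) s)"
      by (subst sum.swap) (simp add: sum.cartesian_product)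
    also have "\<dots> = (\<Sum>b\<in>(UNIV::bool set). \<Sum>g\<in>G. if g = \<gamma> (s, b) then 1 else 0)"
      by (intro sum.cong) (auto simp: B_def indicator_def)
    also have "\<dots> = 2"
      using \<gamma>(1) G by (simp add: sum.delta)
    finally show ?thesis .
  qed
  have le1: "(\<Sum>p\<in>?I. indicat_real (fst p ` B p) t) \<le> 1" for t
  proof -
    have "disjoint_family_on (\<lambda>p. fst p ` B p) ?I"
      unfolding disjoint_family_on_def
    proof (intro ballI impI, rule ccontr)
      fix p q assume "p \<noteq> q" "fst p ` B p \<inter> fst q ` B q \<noteq> {}"
      then obtain s s' where s: "s \<in> B p" "s' \<in> B q" "fst p s = fst q s'" by auto
      then have "\<phi> (s, snd p) = \<phi> (s', snd q)"
        by (simp add: \<gamma>(2) B_def)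
      then have "s = s'" "snd p = snd q"
        using \<phi>(1) by (auto dest: injD)
      then have "p = q"
        using s by (auto simp: B_def prod_eq_iff)
      then show False using \<open>p \<noteq> q\<close> by simp
    qed
    then have "(\<Sum>p\<in>?I. indicat_real (fst p ` B p) t) = indicat_real (\<Union>p\<in>?I. fst p ` B p) t"
      using G by (subst indicator_UN_disjoint) auto
    then show ?thesis by (simp add: indicator_def)
  qed
  \<comment> \<open>The pieces cover every point twice, while their images, of the same mean by
    invariance, cover it at most once.\<close>
  have "2 = m (\<lambda>s. \<Sum>p\<in>?I. indicat_real (B p) s)"
    by (simp only: two mean_const[OF m])
  also have "\<dots> = (\<Sum>p\<in>?I. m (indicat_real (B p)))"
    by (rule mean_sum[OF m ind])
  also have "\<dots> = (\<Sum>p\<in>?I. m (indicat_real (fst p ` B p)))"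
    by (intro sum.cong refl same[symmetric])
  also have "\<dots> = m (\<lambda>t. \<Sum>p\<in>?I. indicat_real (fst p ` B p) t)"
    by (rule mean_sum[OF m ind, symmetric])
  also have "\<dots> \<le> 1"
    by (rule mean_le[OF m linf_sum[OF ind] le1])
  finally show False by simp
qed

text \<open>Without such an \<open>F\<close>, every finite set grows by the factor
  \<open>1 + \<epsilon>\<close> under \<open>K\<close> together with the identity. Composing these
  maps \<open>n\<close> times, with \<open>(1 + \<epsilon>) ^ n > 2\<close>, gives the doubling that
  \<open>mean_not_doubling\<close> forbids.\<close>

lemma foelner_set:
  fixes K :: "'s::semigroup_mult set" and \<epsilon> :: real
  assumes inj: "\<And>s::'s. inj (left_mult s)" and am: "left_amenable TYPE('s)"
    and K: "finite K" and \<epsilon>: "\<epsilon> > 0"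
  obtains F where "finite F" "F \<noteq> {}"
    "real (card (F \<union> (\<Union>k\<in>K. left_mult k ` F))) \<le> (1 + \<epsilon>) * card F"
proof (rule ccontr)
  assume none: "\<not> thesis"
  note found = that
  from am obtain m :: "('s \<Rightarrow> real) \<Rightarrow> real" where m: "is_mean m" and li: "left_invariant m"
    unfolding left_amenable_def by auto
  \<comment> \<open>These are the two properties required by \<open>mean_not_doubling\<close>. Both
    survive composition, and the identity, needed in \<open>G0\<close>, has them without being a
    left multiplication by assumption.\<close>
  define good where "good g \<longleftrightarrow> inj g \<and> (\<forall>f\<in>linf. m (f \<circ> g) = m f)" for g
  define G0 where "G0 = insert id (left_mult ` K)"
  have G0: "finite G0" "\<And>g. g \<in> G0 \<Longrightarrow> good g"
    using K li inj by (auto simp: G0_def good_def left_invariant_def)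
  have U0: "(\<Union>g\<in>G0. g ` F) = F \<union> (\<Union>k\<in>K. left_mult k ` F)" for F
    by (auto simp: G0_def)
  have step: "(1 + \<epsilon>) * card F \<le> card (\<Union>g\<in>G0. g ` F)" if F: "finite F" for F
    using none found[of F] F unfolding U0 by (cases "F = {}") force+
  have "\<exists>G. finite G \<and> (\<forall>g\<in>G. good g) \<and>
      (\<forall>F. finite F \<longrightarrow> (1 + \<epsilon>) ^ n * card F \<le> card (\<Union>g\<in>G. g ` F))" for n
  proof (induction n)
    case 0
    have "good id" using G0(2) by (simp add: G0_def)
    then show ?case by (intro exI[of _ "{id}"] conjI) (simp, blast, simp)
  next
    case (Suc n)
    then obtain G where G: "finite G" "\<And>g. g \<in> G \<Longrightarrow> good g"
      and grow: "\<And>F. finite F \<Longrightarrow> (1 + \<epsilon>) ^ n * card F \<le> card (\<Union>g\<in>G. g ` F)" by blast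
    define G' where "G' = (\<lambda>(g, h). g \<circ> h) ` (G \<times> G0)"
    have "finite G'" using G G0 by (simp add: G'_def)
    moreover have "good g" if g: "g \<in> G'" for g
    proof -
      obtain g1 g2 where g12: "g = g1 \<circ> g2" "good g1" "good g2"
        using g G G0 by (auto simp: G'_def)
      have "m (f \<circ> (g1 \<circ> g2)) = m f" if f: "f \<in> linf" for f
        using g12 f linf_comp[OF f, of g1] by (simp add: good_def o_assoc)
      then show ?thesis
        using g12 by (auto simp: good_def intro: inj_compose)
    qed
    moreover have "(1 + \<epsilon>) ^ Suc n * card F \<le> card (\<Union>g\<in>G'. g ` F)" if F: "finite F" for F
    proof -
      have "(1 + \<epsilon>) ^ Suc n * card F = (1 + \<epsilon>) ^ n * ((1 + \<epsilon>) * card F)" by simp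
      also have "\<dots> \<le> (1 + \<epsilon>) ^ n * card (\<Union>g\<in>G0. g ` F)"
        using step[OF F] \<epsilon> by (intro mult_left_mono) auto
      also have "\<dots> \<le> card (\<Union>g\<in>G. g ` (\<Union>g\<in>G0. g ` F))"
        using G0 F by (intro grow) auto
      also have "(\<Union>g\<in>G. g ` (\<Union>g\<in>G0. g ` F)) = (\<Union>g\<in>G'. g ` F)"
        unfolding G'_def by force
      finally show ?thesis .
    qed
    ultimately show ?case by blast
  qed
  note G_ex = this
  obtain n where n: "2 < (1 + \<epsilon>) ^ n"
    using real_arch_pow[of "1 + \<epsilon>" 2] \<epsilon> by auto
  obtain G where G: "finite G" "\<And>g. g \<in> G \<Longrightarrow> good g"
    and grow: "\<And>F. finite F \<Longrightarrow> (1 + \<epsilon>) ^ n * card F \<le> card (\<Union>g\<in>G. g ` F)"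
    using G_ex[of n] by blast
  obtain F where F: "finite F" "card (\<Union>g\<in>G. g ` F) < 2 * card F"
    using mean_not_doubling[OF m G(1)] G(2) unfolding good_def by blast
  have "2 * real (card F) \<le> (1 + \<epsilon>) ^ n * card F"
    using n by (intro mult_right_mono) auto
  also have "\<dots> \<le> card (\<Union>g\<in>G. g ` F)" by (rule grow[OF F(1)])
  finally show False using F(2) by linarith
qed

section \<open>Counting patterns\<close>

text \<open>A pattern is determined by its restrictions to the disjoint blocks and to the rest of
  \<open>E\<close>, and each block has one forbidden value. The factor
  \<open>card A ^ (w * card T)\<close> on the left avoids a division.\<close>

lemma card_avoiding_patterns:
  fixes A :: "'a set" and B :: "'t \<Rightarrow> 's set"
  assumes A: "finite A" and E: "finite E" and T: "finite T"
    and sub: "\<And>t. t \<in> T \<Longrightarrow> B t \<subseteq> E" and disj: "disjoint_family_on B T"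
    and size: "\<And>t. t \<in> T \<Longrightarrow> card (B t) = w"
    and z: "\<And>t. t \<in> T \<Longrightarrow> z t \<in> B t \<rightarrow>\<^sub>E A"
  shows "card {p \<in> E \<rightarrow>\<^sub>E A. \<forall>t\<in>T. restrict p (B t) \<noteq> z t} * card A ^ (w * card T)
    \<le> (card A ^ w - 1) ^ card T * card A ^ card E"
proof -
  let ?P = "{p \<in> E \<rightarrow>\<^sub>E A. \<forall>t\<in>T. restrict p (B t) \<noteq> z t}"
  define R where "R = E - (\<Union>t\<in>T. B t)"
  define V where "V = (\<Pi>\<^sub>E t\<in>T. (B t \<rightarrow>\<^sub>E A) - {z t}) \<times> (R \<rightarrow>\<^sub>E A)"
  define h where "h p = (\<lambda>t\<in>T. restrict p (B t), restrict p R)" for p :: "'s \<Rightarrow> 'a"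
  have finB: "finite (B t)" if "t \<in> T" for t
    using finite_subset[OF sub[OF that] E] .
  have finBA: "finite (B t \<rightarrow>\<^sub>E A)" if "t \<in> T" for t
    using finB[OF that] A by (intro finite_PiE) auto
  have finR: "finite R" using E by (simp add: R_def)
  have "finite V"
    unfolding V_def using T A finBA finR by (intro finite_cartesian_product finite_PiE) auto
  moreover have "h ` ?P \<subseteq> V"
  proof (intro subsetI, elim imageE)
    fix v p assume v: "v = h p" and p: "p \<in> ?P"
    have "restrict p (B t) \<in> B t \<rightarrow>\<^sub>E A" if "t \<in> T" for t
      using p sub[OF that] by (auto simp: PiE_iff)
    moreover have "restrict p R \<in> R \<rightarrow>\<^sub>E A"
      using p by (auto simp: PiE_iff R_def)
    ultimately show "v \<in> V"
      using p by (auto simp: v h_def V_def)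
  qed
  moreover have "inj_on h ?P"
  proof (rule inj_onI)
    fix p q assume p: "p \<in> ?P" and q: "q \<in> ?P" and eq: "h p = h q"
    have "p s = q s" if s: "s \<in> E" for s
    proof (cases "s \<in> R")
      case True
      then show ?thesis using eq unfolding h_def by (metis restrict_apply' snd_conv)
    next
      case False
      then obtain t where t: "t \<in> T" "s \<in> B t" using s by (auto simp: R_def)
      then have "restrict p (B t) = restrict q (B t)"
        using eq unfolding h_def by (metis restrict_apply' fst_conv)
      then show ?thesis using t by (metis restrict_apply')
    qed
    then show "p = q"
      using p q by (intro PiE_ext[of p E "\<lambda>_. A" q]) auto
  qed
  ultimately have "card ?P \<le> card V"
    by (intro card_inj_on_le)
  also have "card V = (\<Prod>t\<in>T. card ((B t \<rightarrow>\<^sub>E A) - {z t})) * card A ^ card R"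
    unfolding V_def using T finR by (simp add: card_cartesian_product card_PiE)
  also have "(\<Prod>t\<in>T. card ((B t \<rightarrow>\<^sub>E A) - {z t})) = (\<Prod>t\<in>T. card A ^ w - 1)"
    using z finB size finBA by (intro prod.cong) (auto simp: card_PiE)
  finally have le: "card ?P \<le> (card A ^ w - 1) ^ card T * card A ^ card R"
    by (simp only: prod_constant)
  have "card (\<Union>t\<in>T. B t) = (\<Sum>t\<in>T. card (B t))"
    using T finB disj by (intro card_UN_disjoint) (auto simp: disjoint_family_on_def)
  then have "card (\<Union>t\<in>T. B t) = w * card T"
    using size by simp
  moreover have "(\<Union>t\<in>T. B t) \<subseteq> E" using sub by auto
  ultimately have "card E = card R + w * card T"
    unfolding R_def using E by (metis card_Diff_subset card_mono finite_subset le_add_diff_inverse2)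
  then have eq: "(card A ^ w - 1) ^ card T * card A ^ card E
      = (card A ^ w - 1) ^ card T * card A ^ card R * card A ^ (w * card T)"
    by (simp add: power_add)
  show ?thesis
    unfolding eq by (rule mult_le_mono1[OF le])
qed

text \<open>A maximal \<open>T\<close> works: every translate \<open>\<Omega> s\<close> inside \<open>F\<close> meets one of the chosen \<open>\<Omega> t\<close>, and left
  cancellativity leaves at most \<open>(card \<Omega>)\<^sup>2\<close> such \<open>s\<close> for each \<open>t\<close>.\<close>

lemma disjoint_translates:
  fixes F \<Omega> :: "'s::semigroup_mult set"
  assumes inj: "\<And>s::'s. inj (left_mult s)" and F: "finite F" and \<Omega>: "finite \<Omega>" "\<Omega> \<noteq> {}"
  obtains T where "finite T" "\<And>t. t \<in> T \<Longrightarrow> right_mult t ` \<Omega> \<subseteq> F"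
    "disjoint_family_on (\<lambda>t. right_mult t ` \<Omega>) T"
    "card {s \<in> F. right_mult s ` \<Omega> \<subseteq> F} \<le> card T * (card \<Omega>)\<^sup>2"
proof -
  define D where "D = {s \<in> F. right_mult s ` \<Omega> \<subseteq> F}"
  have D: "finite D" using F by (simp add: D_def)
  define P where "P T \<longleftrightarrow> T \<subseteq> D \<and> disjoint_family_on (\<lambda>t. right_mult t ` \<Omega>) T" for T
  have "\<exists>T. P T \<and> (\<forall>T'. P T' \<longrightarrow> card T' \<le> card T)"
    using D by (intro ex_has_greatest_nat[where k = "{}" and b = "Suc (card D)"])
      (auto simp: P_def disjoint_family_on_def card_mono less_Suc_eq_le)
  then obtain T where T: "P T" and max: "\<And>T'. P T' \<Longrightarrow> card T' \<le> card T" by auto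
  have finT: "finite T" using T D finite_subset by (auto simp: P_def)
  \<comment> \<open>A translate by \<open>s\<close> meets the one by \<open>t\<close> when
    \<open>a * s = b * t\<close>, and left cancellation then recovers \<open>s\<close> from the
    triple. Triples without a solution contribute arbitrary points, harmless for an upper
    bound.\<close>
  define C where "C = (\<lambda>(t, a, b). SOME s. a * s = b * t) ` (T \<times> \<Omega> \<times> \<Omega>)"
  have "D \<subseteq> C"
  proof
    fix s assume s: "s \<in> D"
    have "\<exists>t\<in>T. right_mult s ` \<Omega> \<inter> right_mult t ` \<Omega> \<noteq> {}"
    proof (cases "s \<in> T")
      case True
      then show ?thesis using \<Omega> by auto
    next
      case False
      show ?thesis
      proof (rule ccontr)
        assume no: "\<not> ?thesis"
        have "P (insert s T)"
          using T s no False unfolding P_def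
          by (auto simp: disjoint_family_on_insert disjoint_family_on_def)
        then show False using max[of "insert s T"] False finT by simp
      qed
    qed
    then obtain t a b where t: "t \<in> T" "a \<in> \<Omega>" "b \<in> \<Omega>" "a * s = b * t"
      by (auto simp: right_mult_def)
    have "(SOME s. a * s = b * t) = s"
    proof (rule some_equality)
      show "s' = s" if "a * s' = b * t" for s'
        using inj[of a] that t(4) by (auto simp: inj_def left_mult_def)
    qed (rule t(4))
    then show "s \<in> C"
      unfolding C_def using t by (intro rev_image_eqI[of "(t, a, b)"]) auto
  qed
  then have "card D \<le> card C"
    using finT \<Omega> by (intro card_mono) (auto simp: C_def)
  also have "\<dots> \<le> card (T \<times> \<Omega> \<times> \<Omega>)"
    unfolding C_def using finT \<Omega> by (intro card_image_le) auto
  also have "\<dots> = card T * (card \<Omega>)\<^sup>2"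
    by (simp add: card_cartesian_product power2_eq_square)
  finally show ?thesis
    using T finT by (intro that[of T]) (auto simp: P_def D_def)
qed

text \<open>Points leaving \<open>F\<close> under \<open>k\<close> have distinct images in the
  enlargement, hence are few. Points entering \<open>F\<close> are no more numerous: together with
  those that stay they embed into \<open>F\<close> by \<open>left_mult k\<close>, and
  \<open>F\<close> is the union of those that stay and those that leave. No inverse of
  \<open>k\<close> is needed.\<close>

lemma card_escaping:
  fixes F :: "'s::semigroup_mult set" and \<epsilon> :: real
  assumes inj: "\<And>s::'s. inj (left_mult s)" and F: "finite F" and K: "finite K" "k \<in> K"
    and small: "real (card (F \<union> (\<Union>k\<in>K. left_mult k ` F))) \<le> (1 + \<epsilon>) * card F"
  shows "real (card {s \<in> F. k * s \<notin> F}) \<le> \<epsilon> * card F"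
    and "finite {s. s \<notin> F \<and> k * s \<in> F}"
    and "real (card {s. s \<notin> F \<and> k * s \<in> F}) \<le> \<epsilon> * card F"
proof -
  let ?X = "{s \<in> F. k * s \<notin> F}" and ?Y = "{s. s \<notin> F \<and> k * s \<in> F}" and ?Z = "{s \<in> F. k * s \<in> F}"
  have inj': "inj_on (left_mult k) B" for B
    using inj[of k] by (rule inj_on_subset) simp
  have "card F + card ?X = card (F \<union> left_mult k ` ?X)"
    using F card_image[OF inj'[of ?X]]
    by (subst card_Un_disjoint) (auto simp: left_mult_def)
  also have "\<dots> \<le> card (F \<union> (\<Union>k\<in>K. left_mult k ` F))"
    using F K by (intro card_mono) auto
  finally have "real (card F + card ?X) \<le> (1 + \<epsilon>) * card F"
    using small by linarith
  then show X: "real (card ?X) \<le> \<epsilon> * card F"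
    by (simp add: algebra_simps)
  have sub: "left_mult k ` (?Y \<union> ?Z) \<subseteq> F" by (auto simp: left_mult_def)
  have "finite (?Y \<union> ?Z)"
    by (rule finite_imageD[OF finite_subset[OF sub F] inj'])
  then show Y: "finite ?Y" by simp
  have "card ?Y + card ?Z = card (?Y \<union> ?Z)"
    using Y F by (subst card_Un_disjoint) auto
  also have "\<dots> = card (left_mult k ` (?Y \<union> ?Z))"
    by (rule card_image[OF inj', symmetric])
  also have "\<dots> \<le> card F"
    using F sub by (rule card_mono)
  also have "card F = card (?X \<union> ?Z)"
    by (rule arg_cong[of _ _ card]) auto
  also have "\<dots> = card ?X + card ?Z"
    using F by (subst card_Un_disjoint) auto
  finally show "real (card ?Y) \<le> \<epsilon> * card F"
    using X by simp
qed

section \<open>Cellular automata\<close>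

lemma shift_configs: "x \<in> configs A \<Longrightarrow> shift s x \<in> configs A"
  by (auto simp: configs_def shift_def)

lemma cellular_automaton_local:
  assumes "cellular_automaton A \<tau>"
  obtains M where "finite M"
    "\<And>x x' s. x \<in> configs A \<Longrightarrow> x' \<in> configs A \<Longrightarrow> (\<And>t. t \<in> M \<Longrightarrow> x (t * s) = x' (t * s)) \<Longrightarrow>
      \<tau> x s = \<tau> x' s"
proof -
  from assms obtain M \<mu> where M: "finite M"
    and \<tau>: "\<And>x s. x \<in> configs A \<Longrightarrow> \<tau> x s = \<mu> (restrict (shift s x) M)"
    unfolding cellular_automaton_def by blast
  show ?thesis
  proof (rule that[OF M])
    fix x x' s assume x: "x \<in> configs A" "x' \<in> configs A" "\<And>t. t \<in> M \<Longrightarrow> x (t * s) = x' (t * s)"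
    then have "restrict (shift s x) M = restrict (shift s x') M"
      by (auto simp: shift_def restrict_def)
    then show "\<tau> x s = \<tau> x' s" using x \<tau> by simp
  qed
qed

text \<open>By associativity successive shifts compose to one shift by \<open>t * s\<close>. This
  equivariance carries a forbidden pattern to all its right translates.\<close>

lemma cellular_automaton_shift:
  assumes "cellular_automaton A \<tau>" "x \<in> configs A"
  shows "\<tau> (shift s x) t = \<tau> x (t * s)"
proof -
  from assms obtain M \<mu> where
    \<tau>: "\<And>x s. x \<in> configs A \<Longrightarrow> \<tau> x s = \<mu> (restrict (shift s x) M)"
    unfolding cellular_automaton_def by blast
  have "shift t (shift s x) = shift (t * s) x"
    by (simp add: shift_def mult.assoc)
  then show ?thesis
    using \<tau> assms(2) shift_configs[OF assms(2)] by metis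
qed

text \<open>If every finite part of \<open>y\<close> occurred in some image, compactness would
  assemble a preimage of \<open>y\<close>.\<close>

lemma garden_of_eden_pattern:
  fixes \<tau> :: "('s::semigroup_mult \<Rightarrow> 'a) \<Rightarrow> 's \<Rightarrow> 'a"
  assumes \<tau>: "cellular_automaton A \<tau>" and A: "finite A" and y: "y \<in> configs A - \<tau> ` configs A"
  obtains \<Omega> where "finite \<Omega>" "\<And>x. x \<in> configs A \<Longrightarrow> \<exists>s\<in>\<Omega>. \<tau> x s \<noteq> y s"
proof (rule ccontr)
  assume no: "\<not> thesis"
  note found = that
  obtain M where M: "finite M" and loc: "\<And>x x' s. x \<in> configs A \<Longrightarrow> x' \<in> configs A \<Longrightarrow>
      (\<And>t. t \<in> M \<Longrightarrow> x (t * s) = x' (t * s)) \<Longrightarrow> \<tau> x s = \<tau> x' s"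
    using cellular_automaton_local[OF \<tau>] by metis
  \<comment> \<open>Only those \<open>s\<close> whose whole neighbourhood lies in \<open>I\<close>
    are tested, so \<open>Q I\<close> depends on the coordinates in \<open>I\<close> alone and
    becomes stronger as \<open>I\<close> grows.\<close>
  define Q where "Q I x \<longleftrightarrow> (\<forall>s\<in>I. right_mult s ` M \<subseteq> I \<longrightarrow> \<tau> x s = y s)" for I x
  have ex: "\<exists>f\<in>UNIV \<rightarrow> A. Q I f" if I: "finite I" for I
  proof (rule ccontr)
    assume "\<not> ?thesis"
    then have thesis
      by (intro found[OF I]) (auto simp: Q_def configs_def)
    then show False using no by simp
  qed
  obtain x where x: "x \<in> configs A" and Qx: "\<And>I. finite I \<Longrightarrow> Q I x"
  proof (rule finite_choice_compactness[of "\<lambda>_. A" Q])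
    show "Q I g" if fg: "f \<in> UNIV \<rightarrow> A" "g \<in> UNIV \<rightarrow> A"
      and eq: "\<And>i. i \<in> I \<Longrightarrow> f i = g i" and f: "Q I f" for I f g
      unfolding Q_def
    proof (intro ballI impI)
      fix s assume s: "s \<in> I" "right_mult s ` M \<subseteq> I"
      then have "\<tau> g s = \<tau> f s"
        using fg by (intro loc) (auto simp: configs_def right_mult_def image_subset_iff eq)
      then show "\<tau> g s = y s" using s f by (simp add: Q_def)
    qed
    show "Q I f" if "I \<subseteq> J" "Q J f" for I J f
      using that unfolding Q_def by blast
  qed (use A ex in \<open>auto simp: configs_def\<close>)
  have "\<tau> x s = y s" for s
    using Qx[of "insert s (right_mult s ` M)"] M by (auto simp: Q_def)
  then have "\<tau> x = y" by auto
  then show False using x y by auto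
qed

text \<open>Changing a fixed configuration on \<open>F\<close> affects its image only on \<open>F\<close> and the set of \<open>s\<close> with
  \<open>M s\<close> meeting \<open>F\<close>, so injectivity embeds the patterns on \<open>F\<close> into the patterns on this
  slightly larger set that avoid every translate of the Garden-of-Eden pattern.\<close>

theorem corollary1p2:
  fixes A :: "'a set"
    and \<tau> :: "('s::semigroup_mult \<Rightarrow> 'a) \<Rightarrow> 's \<Rightarrow> 'a"
  assumes "cancellative TYPE('s)"
    and "left_amenable TYPE('s)"
    and "finite A"
    and "cellular_automaton A \<tau>"
    and "inj_on \<tau> (configs A)"
  shows "\<tau> ` configs A = configs A"
proof (rule ccontr)
  assume ns: "\<tau> ` configs A \<noteq> configs A"
  have injL: "inj (left_mult s)" and injR: "inj (right_mult s)" for s :: 's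
    using assms(1) by (auto simp: cancellative_def)
  have \<tau>A: "\<tau> x \<in> configs A" if "x \<in> configs A" for x
    using assms(4) that by (auto simp: cellular_automaton_def)
  then obtain y where y: "y \<in> configs A - \<tau> ` configs A"
    using ns by auto
  obtain \<Omega> where \<Omega>: "finite \<Omega>" and eden: "\<And>x. x \<in> configs A \<Longrightarrow> \<exists>s\<in>\<Omega>. \<tau> x s \<noteq> y s"
    using garden_of_eden_pattern[OF assms(4,3) y] by metis
  obtain M where M: "finite M" and loc: "\<And>x x' s. x \<in> configs A \<Longrightarrow> x' \<in> configs A \<Longrightarrow>
      (\<And>t. t \<in> M \<Longrightarrow> x (t * s) = x' (t * s)) \<Longrightarrow> \<tau> x s = \<tau> x' s"
    using cellular_automaton_local[OF assms(4)] by metis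
  have \<Omega>_ne: "\<Omega> \<noteq> {}"
    using eden y by blast
  have yA: "y t \<in> A" for t using y by (auto simp: configs_def)
  define q where "q = card A"
  define w where "w = card \<Omega>"
  have q: "q \<ge> 1"
    using yA[of undefined] assms(3) unfolding q_def by (metis One_nat_def Suc_leI card_gt_0_iff empty_iff)
  have w: "w \<ge> 1"
    using \<Omega> \<Omega>_ne unfolding w_def by (metis One_nat_def Suc_leI card_gt_0_iff)

  \<comment> \<open>The closing estimate bounds \<open>N\<close> by
    \<open>w + w\<^sup>2 * q ^ w * card M * ln q\<close> times \<open>\<epsilon> * N\<close>. Here
    \<open>d\<close> is at least twice that factor, so \<open>\<epsilon> = 1 / d\<close> yields
    \<open>2 * N \<le> N\<close>. The term \<open>2 * w\<close> keeps \<open>d\<close> positive even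
    when \<open>q = 1\<close> or \<open>M\<close> is empty.\<close>
  define d where "d = 2 * w + 4 * w\<^sup>2 * q ^ w * card M * ln q"
  define \<epsilon> where "\<epsilon> = 1 / d"
  have "0 \<le> 4 * w\<^sup>2 * q ^ w * card M * ln q" using q by simp
  then have d: "d > 0"
    unfolding d_def using w by (intro add_pos_nonneg) auto
  then have \<epsilon>: "\<epsilon> > 0" and \<epsilon>_d: "d * \<epsilon> = 1"
    by (simp_all add: \<epsilon>_def)
  obtain F where F: "finite F" "F \<noteq> {}"
    and small: "real (card (F \<union> (\<Union>k\<in>M \<union> \<Omega>. left_mult k ` F))) \<le> (1 + \<epsilon>) * card F"
    using foelner_set[OF injL assms(2) _ \<epsilon>, of "M \<union> \<Omega>"] M \<Omega> by (metis finite_UnI)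
  have MO: "finite (M \<union> \<Omega>)" using M \<Omega> by simp
  note escape = card_escaping[OF injL F(1) MO _ small]
  define N where "N = card F"
  have N: "N \<ge> 1" unfolding N_def using F by (metis One_nat_def Suc_leI card_gt_0_iff)

  \<comment> \<open>For \<open>s\<close> outside \<open>E\<close>, no \<open>k * s\<close> with
    \<open>k\<close> in \<open>M\<close> lies in \<open>F\<close>, unless \<open>s\<close> does.
    \<open>F\<close> itself is included so that the chosen translates of \<open>\<Omega>\<close> lie
    in \<open>E\<close>.\<close>
  define E where "E = F \<union> (\<Union>k\<in>M. {s. s \<notin> F \<and> k * s \<in> F})"
  have E: "finite E" unfolding E_def using F M escape(2) by auto
  have "real (card E) \<le> card F + real (card (\<Union>k\<in>M. {s. s \<notin> F \<and> k * s \<in> F}))"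
    unfolding E_def of_nat_add[symmetric] of_nat_le_iff by (rule card_Un_le)
  also have "real (card (\<Union>k\<in>M. {s. s \<notin> F \<and> k * s \<in> F})) \<le> (\<Sum>k\<in>M. card {s. s \<notin> F \<and> k * s \<in> F})"
    using card_UN_le[OF M] of_nat_le_iff by blast
  also have "real (\<Sum>k\<in>M. card {s. s \<notin> F \<and> k * s \<in> F}) \<le> (\<Sum>k\<in>M. \<epsilon> * N)"
    unfolding of_nat_sum N_def by (intro sum_mono escape(3)) auto
  finally have cardE: "real (card E) \<le> N + card M * (\<epsilon> * N)"
    by (simp add: N_def)

  obtain T where T: "finite T" "\<And>t. t \<in> T \<Longrightarrow> right_mult t ` \<Omega> \<subseteq> F"
    and disj: "disjoint_family_on (\<lambda>t. right_mult t ` \<Omega>) T"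
    and many: "card {s \<in> F. right_mult s ` \<Omega> \<subseteq> F} \<le> card T * w\<^sup>2"
    using disjoint_translates[OF injL F(1) \<Omega> \<Omega>_ne, folded w_def] by blast
  \<comment> \<open>A point of \<open>F\<close> whose translate of \<open>\<Omega>\<close> is not
    inside \<open>F\<close> escapes under some \<open>k\<close> in \<open>\<Omega>\<close>. Few
    points do, so \<open>card T\<close> is at least a fixed proportion of \<open>N\<close>.\<close>
  have "F \<subseteq> {s \<in> F. right_mult s ` \<Omega> \<subseteq> F} \<union> (\<Union>k\<in>\<Omega>. {s \<in> F. k * s \<notin> F})"
    by (auto simp: right_mult_def)
  then have "card F \<le> card ({s \<in> F. right_mult s ` \<Omega> \<subseteq> F} \<union> (\<Union>k\<in>\<Omega>. {s \<in> F. k * s \<notin> F}))"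
    using F \<Omega> by (intro card_mono) auto
  also have "\<dots> \<le> card {s \<in> F. right_mult s ` \<Omega> \<subseteq> F} + card (\<Union>k\<in>\<Omega>. {s \<in> F. k * s \<notin> F})"
    by (rule card_Un_le)
  also have "\<dots> \<le> card T * w\<^sup>2 + (\<Sum>k\<in>\<Omega>. card {s \<in> F. k * s \<notin> F})"
    using many \<Omega> by (intro add_mono card_UN_le)
  finally have "real N \<le> real (card T * w\<^sup>2) + real (\<Sum>k\<in>\<Omega>. card {s \<in> F. k * s \<notin> F})"
    unfolding N_def by linarith
  also have "real (\<Sum>k\<in>\<Omega>. card {s \<in> F. k * s \<notin> F}) \<le> (\<Sum>k\<in>\<Omega>. \<epsilon> * N)"
    unfolding of_nat_sum N_def by (intro sum_mono escape(1)) auto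
  finally have cardT: "real N \<le> card T * w\<^sup>2 + w * (\<epsilon> * N)"
    by (simp add: w_def)

  \<comment> \<open>This is \<open>y\<close> on \<open>\<Omega>\<close> transported to the translate
    by \<open>t\<close>. Right cancellativity makes the inverse meaningful on that
    translate.\<close>
  define z where "z t = (\<lambda>u\<in>right_mult t ` \<Omega>. y (inv (right_mult t) u))" for t
  define P where "P = {p \<in> E \<rightarrow>\<^sub>E A. \<forall>t\<in>T. restrict p (right_mult t ` \<Omega>) \<noteq> z t}"
  have TE: "right_mult t ` \<Omega> \<subseteq> E" if "t \<in> T" for t
    using T(2)[OF that] by (auto simp: E_def)
  have count: "card P * q ^ (w * card T) \<le> (q ^ w - 1) ^ card T * q ^ card E"
    unfolding P_def q_def
  proof (rule card_avoiding_patterns[OF assms(3) E T(1) TE disj])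
    show "card (right_mult t ` \<Omega>) = w" for t
      unfolding w_def using injR[of t] by (intro card_image) (auto intro: inj_on_subset)
    show "z t \<in> right_mult t ` \<Omega> \<rightarrow>\<^sub>E A" for t
      by (auto simp: z_def yA)
  qed

  \<comment> \<open>Any fixed configuration could serve as the background outside \<open>F\<close>;
    \<open>y\<close> is at hand.\<close>
  define ext where "ext p = (\<lambda>s. if s \<in> F then p s else y s)" for p
  have ext: "ext p \<in> configs A" if "p \<in> F \<rightarrow>\<^sub>E A" for p
    using that yA by (auto simp: ext_def configs_def)
  have "inj_on (\<lambda>p. restrict (\<tau> (ext p)) E) (F \<rightarrow>\<^sub>E A)"
  proof (rule inj_onI)
    fix p p' assume p: "p \<in> F \<rightarrow>\<^sub>E A" "p' \<in> F \<rightarrow>\<^sub>E A"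
      and eq: "restrict (\<tau> (ext p)) E = restrict (\<tau> (ext p')) E"
    have "\<tau> (ext p) s = \<tau> (ext p') s" for s
    proof (cases "s \<in> E")
      case True
      then show ?thesis using eq by (metis restrict_apply')
    next
      case False
      then show ?thesis
        using p by (intro loc ext) (auto simp: ext_def E_def)
    qed
    then have "\<tau> (ext p) = \<tau> (ext p')" by auto
    then have "ext p = ext p'"
      by (rule inj_onD[OF assms(5) _ ext[OF p(1)] ext[OF p(2)]])
    then have "p s = p' s" if "s \<in> F" for s
      using that unfolding ext_def by meson
    then show "p = p'"
      using p by (intro PiE_ext[of p F "\<lambda>_. A" p']) auto
  qed
  moreover have "(\<lambda>p. restrict (\<tau> (ext p)) E) ` (F \<rightarrow>\<^sub>E A) \<subseteq> P"
  proof (rule image_subsetI)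
    fix p assume p: "p \<in> F \<rightarrow>\<^sub>E A"
    have "restrict (restrict (\<tau> (ext p)) E) (right_mult t ` \<Omega>) \<noteq> z t" if t: "t \<in> T" for t
    proof
      assume eq: "restrict (restrict (\<tau> (ext p)) E) (right_mult t ` \<Omega>) = z t"
      \<comment> \<open>Equivariance moves the occurrence of \<open>z t\<close> back to
        \<open>\<Omega>\<close>, where the image of the shifted configuration would agree with
        \<open>y\<close>.\<close>
      have "\<tau> (shift t (ext p)) s = y s" if s: "s \<in> \<Omega>" for s
      proof -
        have st: "right_mult t s \<in> right_mult t ` \<Omega>" using s by simp
        have "\<tau> (ext p) (right_mult t s) = z t (right_mult t s)"
          using fun_cong[OF eq, of "right_mult t s"] st TE[OF t] by auto
        also have "\<dots> = y s"
          using st injR[of t] by (simp add: z_def)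
        finally show ?thesis
          using cellular_automaton_shift[OF assms(4) ext[OF p]] by (simp add: right_mult_def)
      qed
      then show False
        using eden[OF shift_configs[OF ext[OF p]]] by blast
    qed
    then show "restrict (\<tau> (ext p)) E \<in> P"
      using \<tau>A[OF ext[OF p]] by (auto simp: P_def configs_def)
  qed
  moreover have "finite P"
    unfolding P_def using E assms(3) by (simp add: finite_PiE)
  ultimately have "card (F \<rightarrow>\<^sub>E A) \<le> card P"
    by (rule card_inj_on_le)
  then have "q ^ N \<le> card P"
    using F(1) by (simp add: card_PiE q_def N_def)
  then have "q ^ N * q ^ (w * card T) \<le> (q ^ w - 1) ^ card T * q ^ card E"
    using count by (meson le_trans mult_le_mono1)
  then have "real (q ^ N * q ^ (w * card T)) \<le> real ((q ^ w - 1) ^ card T * q ^ card E)"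
    by (rule of_nat_mono)
  also have "\<dots> = (real q ^ w - 1) ^ card T * real q ^ card E"
    using q by (simp add: of_nat_diff)
  also have "real q ^ w - 1 = (1 - 1 / real q ^ w) * real q ^ w"
    using q by (simp add: field_simps)
  also have "\<dots> ^ card T * real q ^ card E
      = (1 - 1 / real q ^ w) ^ card T * real q ^ card E * real q ^ (w * card T)"
    by (simp only: power_mult power_mult_distrib mult_ac)
  finally have "real q ^ N * real q ^ (w * card T)
      \<le> (1 - 1 / real q ^ w) ^ card T * real q ^ card E * real q ^ (w * card T)"
    by (simp only: of_nat_mult of_nat_power)
  then have "real q ^ N \<le> (1 - 1 / real q ^ w) ^ card T * real q ^ card E"
    by (rule mult_right_le_imp_le) (use q in simp)
  \<comment> \<open>With \<open>1 + u \<le> exp u\<close>, comparing exponents gives an inequality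
    linear in \<open>card T\<close> and \<open>card E - N\<close>. The first is proportional to
    \<open>N\<close>, the second at most \<open>\<epsilon> * card M * N\<close>.\<close>
  also have "\<dots> \<le> exp (- 1 / real q ^ w) ^ card T * real q ^ card E"
    using q exp_ge_add_one_self[of "- 1 / real q ^ w"]
    by (intro mult_right_mono power_mono) auto
  finally have "real q ^ N \<le> exp (- 1 / real q ^ w) ^ card T * real q ^ card E" .
  moreover have pow: "real q ^ n = exp (n * ln q)" for n
    using q by (subst exp_of_nat_mult) simp
  ultimately have "exp (N * ln q) \<le> exp (card T * (- 1 / real q ^ w) + card E * ln q)"
    unfolding exp_add exp_of_nat_mult[of "card T"] by (simp only: pow[of N] pow[of "card E"])
  then have "card T / real q ^ w \<le> (card E - real N) * ln q"
    by (simp add: algebra_simps)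
  also have "\<dots> \<le> (card M * (\<epsilon> * N)) * ln q"
    using cardE q by (intro mult_right_mono) auto
  finally have T_le: "real (card T) \<le> card M * (\<epsilon> * N) * ln q * q ^ w"
    using q by (simp add: field_simps)
  have "real N \<le> (card M * (\<epsilon> * N) * ln q * q ^ w) * w\<^sup>2 + w * (\<epsilon> * N)"
    using cardT mult_right_mono[OF T_le, of "w\<^sup>2"] by simp
  then have "2 * real N \<le> 2 * w * (\<epsilon> * N) + 2 * w\<^sup>2 * q ^ w * card M * ln q * (\<epsilon> * N)"
    by (simp add: algebra_simps)
  also have "\<dots> \<le> 2 * w * (\<epsilon> * N) + 4 * w\<^sup>2 * q ^ w * card M * ln q * (\<epsilon> * N)"
    using \<epsilon> q by (intro add_left_mono mult_right_mono) auto
  also have "\<dots> = N * (d * \<epsilon>)"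
    by (simp add: d_def algebra_simps)
  also have "\<dots> = N"
    using \<epsilon>_d by simp
  finally show False using N by simp
qed

end
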